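(* For every integer $k\ge 4$ there are infinitely many (pairwise non-isomorphic) connected signed $k$-regular graphs whose distinct eigenvalues are exactly $\sqrt{k}$ and $-\sqrt{k}$.
   Context: A signed graph is a finite simple graph (the ground graph) together with a sign function $\sigma$ on its edges with values in $\{1,-1\}$. It is connected, respectively $k$-regular, if its ground graph is. Its eigenvalues are those of its adjacency matrix, whose $(i,j)$ entry is $\sigma(v_iv_j)$ if $v_i,v_j$ are adjacent and $0$ otherwise. Two signed graphs are isomorphic if there is an isomorphism of the ground graphs preserving the signs of edges. *)

theory Defs
  imports
    "Graph_Theory.Pair_Digraph"
    "Graph_Theory.Digraph_Component"
    "Jordan_Normal_Form.Spectral_Radius"
begin

text \<open>Finite simple graphs are the library's \<^const>\<open>pair_graph\<close>s: finite loop-free digraphs whose arc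
  set is symmetric, so the undirected edge \<open>{u, v}\<close> is the pair of arcs \<open>(u, v)\<close>, \<open>(v, u)\<close>. The sign
  function takes the edge as an unordered pair; its values away from edges are irrelevant.\<close>

record 'a signed_graph =
  ground :: "'a pair_pre_digraph"
  sign :: "'a set \<Rightarrow> int"

definition signed_graph :: "'a signed_graph \<Rightarrow> bool" where
  "signed_graph G \<longleftrightarrow> pair_graph (ground G) \<and>
     (\<forall>(u, v) \<in> parcs (ground G). sign G {u, v} \<in> {1, -1})"

definition signed_connected :: "'a signed_graph \<Rightarrow> bool" where
  "signed_connected G \<longleftrightarrow> Digraph_Component.connected (with_proj (ground G))"

text \<open>In a symmetric digraph without multiple arcs the out-degree is the degree of the underlying
  simple graph.\<close>

definition signed_regular :: "nat \<Rightarrow> 'a signed_graph \<Rightarrow> bool" where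
  "signed_regular k G \<longleftrightarrow>
     (\<forall>v \<in> pverts (ground G). out_degree (with_proj (ground G)) v = k)"

definition adj_entry :: "'a signed_graph \<Rightarrow> 'a \<Rightarrow> 'a \<Rightarrow> complex" where
  "adj_entry G u v = (if (u, v) \<in> parcs (ground G) then of_int (sign G {u, v}) else 0)"

definition vertex_orderings :: "'a signed_graph \<Rightarrow> 'a list set" where
  "vertex_orderings G = {vs. distinct vs \<and> set vs = pverts (ground G)}"

definition adj_matrix :: "'a signed_graph \<Rightarrow> 'a list \<Rightarrow> complex mat" where
  "adj_matrix G vs = mat (length vs) (length vs) (\<lambda>(i, j). adj_entry G (vs ! i) (vs ! j))"

text \<open>The adjacency matrix depends on the ordering of the vertices, its eigenvalues do not; see
  \<open>signed_eigenvalues_eq_spectrum\<close> below.\<close>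

definition signed_eigenvalues :: "'a signed_graph \<Rightarrow> complex set" where
  "signed_eigenvalues G = (\<Union>vs \<in> vertex_orderings G. spectrum (adj_matrix G vs))"

definition signed_iso :: "'a signed_graph \<Rightarrow> 'b signed_graph \<Rightarrow> bool" where
  "signed_iso G H \<longleftrightarrow> (\<exists>f. bij_betw f (pverts (ground G)) (pverts (ground H)) \<and>
     (\<forall>u \<in> pverts (ground G). \<forall>v \<in> pverts (ground G).
        (u, v) \<in> parcs (ground G) \<longleftrightarrow> (f u, f v) \<in> parcs (ground H)) \<and>
     (\<forall>(u, v) \<in> parcs (ground G). sign H {f u, f v} = sign G {u, v}))"

lemma eigenvalue_adj_matrix_iff:
  assumes "vs \<in> vertex_orderings G"
  shows "eigenvalue (adj_matrix G vs) x \<longleftrightarrow>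
    (\<exists>f. (\<exists>u \<in> pverts (ground G). f u \<noteq> 0) \<and>
         (\<forall>u \<in> pverts (ground G). (\<Sum>w \<in> pverts (ground G). adj_entry G u w * f w) = x * f u))"
    (is "?L \<longleftrightarrow> ?R")
proof -
  define n where "n = length vs"
  let ?V = "pverts (ground G)"
  have dist: "distinct vs" and setV: "set vs = ?V"
    using assms by (auto simp: vertex_orderings_def)
  have bij: "bij_betw (\<lambda>i. vs ! i) {0..<n} ?V"
    using bij_betw_nth[OF dist, of "{0..<n}" ?V] setV by (auto simp: n_def lessThan_atLeast0)
  have sum_V: "(\<Sum>w \<in> ?V. g w) = (\<Sum>i = 0..<n. g (vs ! i))" for g :: "_ \<Rightarrow> complex"
    using sum.reindex_bij_betw[OF bij, of g] by simp
  have V_iff: "(\<forall>u \<in> ?V. P u) \<longleftrightarrow> (\<forall>i < n. P (vs ! i))" for P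
    unfolding setV[symmetric] n_def by (simp add: all_set_conv_all_nth)
  define A where "A = adj_matrix G vs"
  have dimA: "dim_row A = n" by (simp add: A_def adj_matrix_def n_def)
  have A_nth: "(A *\<^sub>v v) $ i = (\<Sum>j = 0..<n. adj_entry G (vs ! i) (vs ! j) * v $ j)"
    if "i < n" "dim_vec v = n" for v i
    using that by (simp add: A_def adj_matrix_def n_def[symmetric] scalar_prod_def)
  have ev: "eigenvector A v x \<longleftrightarrow> dim_vec v = n \<and> (\<exists>i < n. v $ i \<noteq> 0) \<and>
      (\<forall>i < n. (\<Sum>j = 0..<n. adj_entry G (vs ! i) (vs ! j) * v $ j) = x * v $ i)" for v
  proof (cases "dim_vec v = n")
    case True
    have nz: "v \<noteq> 0\<^sub>v n \<longleftrightarrow> (\<exists>i < n. v $ i \<noteq> 0)"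
      using True by (metis eq_vecI index_zero_vec)
    have "A *\<^sub>v v = x \<cdot>\<^sub>v v \<longleftrightarrow> (\<forall>i < n. (A *\<^sub>v v) $ i = (x \<cdot>\<^sub>v v) $ i)"
      unfolding vec_eq_iff using True dimA by simp
    also have "\<dots> \<longleftrightarrow> (\<forall>i < n. (\<Sum>j = 0..<n. adj_entry G (vs ! i) (vs ! j) * v $ j) = x * v $ i)"
    proof (intro all_cong)
      fix i assume i: "i < n"
      have "(x \<cdot>\<^sub>v v) $ i = x * v $ i" using i True by simp
      then show "((A *\<^sub>v v) $ i = (x \<cdot>\<^sub>v v) $ i) \<longleftrightarrow>
          (\<Sum>j = 0..<n. adj_entry G (vs ! i) (vs ! j) * v $ j) = x * v $ i"
        by (simp only: A_nth[OF i True])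
    qed
    finally show ?thesis
      using True nz unfolding eigenvector_def dimA carrier_vec_def by blast
  next
    case False
    then show ?thesis
      unfolding eigenvector_def dimA carrier_vec_def by blast
  qed
  have "eigenvalue A x \<longleftrightarrow> ?R"
  proof
    assume "eigenvalue A x"
    then obtain v where "eigenvector A v x" unfolding eigenvalue_def by blast
    then obtain i where i: "i < n" "v $ i \<noteq> 0"
      and eq: "\<And>i. i < n \<Longrightarrow> (\<Sum>j = 0..<n. adj_entry G (vs ! i) (vs ! j) * v $ j) = x * v $ i"
      unfolding ev by blast
    define f where "f u = v $ (the_inv_into {0..<n} ((!) vs) u)" for u
    have f: "f (vs ! i) = v $ i" if "i < n" for i
      unfolding f_def using the_inv_into_f_f[OF bij_betw_imp_inj_on[OF bij], of i] that by simp
    have "(\<Sum>j = 0..<n. adj_entry G (vs ! i) (vs ! j) * f (vs ! j)) = x * f (vs ! i)"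
      if "i < n" for i
    proof -
      have "(\<Sum>j = 0..<n. adj_entry G (vs ! i) (vs ! j) * f (vs ! j)) =
          (\<Sum>j = 0..<n. adj_entry G (vs ! i) (vs ! j) * v $ j)"
        by (intro sum.cong refl) (simp add: f)
      then show ?thesis by (simp only: eq[OF that] f[OF that])
    qed
    then have "\<forall>u \<in> ?V. (\<Sum>w \<in> ?V. adj_entry G u w * f w) = x * f u"
      unfolding sum_V V_iff by blast
    moreover have "vs ! i \<in> ?V" using i(1) unfolding setV[symmetric] n_def by (rule nth_mem)
    moreover have "f (vs ! i) \<noteq> 0" using f[OF i(1)] i(2) by simp
    ultimately show ?R by blast
  next
    assume ?R
    then obtain f u where u: "u \<in> ?V" "f u \<noteq> 0"
      and f: "\<forall>u \<in> ?V. (\<Sum>w \<in> ?V. adj_entry G u w * f w) = x * f u" by blast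
    obtain i where i: "i < n" "u = vs ! i"
      using u(1) unfolding setV[symmetric] n_def in_set_conv_nth by blast
    have "eigenvector A (vec n (\<lambda>i. f (vs ! i))) x"
      unfolding ev
    proof (intro conjI allI impI)
      show "\<exists>i < n. vec n (\<lambda>i. f (vs ! i)) $ i \<noteq> 0" using i u(2) by (intro exI[of _ i]) simp
    next
      fix i assume i: "i < n"
      have "(\<Sum>j = 0..<n. adj_entry G (vs ! i) (vs ! j) * vec n (\<lambda>i. f (vs ! i)) $ j) =
          (\<Sum>j = 0..<n. adj_entry G (vs ! i) (vs ! j) * f (vs ! j))"
        by (intro sum.cong refl) simp
      also have "\<dots> = x * f (vs ! i)" using f i unfolding sum_V V_iff by blast
      finally show "(\<Sum>j = 0..<n. adj_entry G (vs ! i) (vs ! j) * vec n (\<lambda>i. f (vs ! i)) $ j) =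
          x * vec n (\<lambda>i. f (vs ! i)) $ i" using i by simp
    qed simp
    then show "eigenvalue A x" unfolding eigenvalue_def by blast
  qed
  then show ?thesis unfolding A_def .
qed

lemma signed_eigenvalues_eq_spectrum:
  assumes "vs \<in> vertex_orderings G"
  shows "signed_eigenvalues G = spectrum (adj_matrix G vs)"
  using assms by (auto simp: signed_eigenvalues_def spectrum_def eigenvalue_adj_matrix_iff)

end

theory Submission
  imports Defs
begin

text \<open>A symmetric matrix \<open>A\<close> with entries \<open>0, 1, -1\<close>, zero diagonal and \<open>A\<^sup>2 = k I\<close> is the
  adjacency matrix of a signed \<open>k\<close>-regular graph: the diagonal of \<open>A\<^sup>2\<close> counts neighbours. Its
  eigenvalues are square roots of \<open>k\<close>, and both occur, because \<open>A e\<^sub>v \<plusminus> \<surd>k e\<^sub>v\<close> is nonzero at \<open>v\<close>.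
  For \<open>k = 4\<close> take \<open>P \<otimes> B + P\<^sup>T \<otimes> B\<^sup>T\<close>, where \<open>P\<close> is the cyclic shift on \<open>n \<ge> 3\<close> points and
  \<open>B\<close> has rows \<open>(1, 1)\<close> and \<open>(-1, -1)\<close>; this works since \<open>B\<^sup>2 = 0\<close> and \<open>B B\<^sup>T + B\<^sup>T B = 4 I\<close>.
  The block matrix with rows \<open>(A, I)\<close> and \<open>(I, -A)\<close> leads from \<open>k\<close> to \<open>k + 1\<close>.\<close>

section \<open>Symmetric signed weighing matrices with connected support\<close>

locale signed_weighing =
  fixes V :: "'a set" and a :: "'a \<Rightarrow> 'a \<Rightarrow> int" and k :: nat
  assumes finite: "finite V" and nonempty: "V \<noteq> {}"
    and entries: "\<And>u v. u \<in> V \<Longrightarrow> v \<in> V \<Longrightarrow> a u v \<in> {-1, 0, 1}"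
    and sym: "\<And>u v. u \<in> V \<Longrightarrow> v \<in> V \<Longrightarrow> a u v = a v u"
    and diag: "\<And>u. u \<in> V \<Longrightarrow> a u u = 0"
    and square: "\<And>u v. u \<in> V \<Longrightarrow> v \<in> V \<Longrightarrow>
      (\<Sum>w \<in> V. a u w * a w v) = (if u = v then int k else 0)"
    and connected: "\<And>u v. u \<in> V \<Longrightarrow> v \<in> V \<Longrightarrow>
      (u, v) \<in> {(x, y). x \<in> V \<and> y \<in> V \<and> a x y \<noteq> 0}\<^sup>*"

lemma signed_weighing_reindex:
  assumes "signed_weighing V a k" "bij_betw f W V"
  shows "signed_weighing W (\<lambda>x y. a (f x) (f y)) k"
proof -
  interpret signed_weighing V a k by fact
  have f: "f u \<in> V" if "u \<in> W" for u using assms(2) that by (auto simp: bij_betw_def)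
  have inj: "f u = f v \<longleftrightarrow> u = v" if "u \<in> W" "v \<in> W" for u v
    using assms(2) that by (auto simp: bij_betw_def inj_on_def)
  let ?g = "the_inv_into W f"
  let ?R = "{(x, y). x \<in> V \<and> y \<in> V \<and> a x y \<noteq> 0}"
  let ?S = "{(x, y). x \<in> W \<and> y \<in> W \<and> a (f x) (f y) \<noteq> 0}"
  have gf: "?g (f u) = u" if "u \<in> W" for u
    using assms(2) that by (auto simp: bij_betw_def the_inv_into_f_f)
  have fg: "?g u \<in> W \<and> f (?g u) = u" if "u \<in> V" for u
    using assms(2) that by (auto simp: bij_betw_def f_the_inv_into_f the_inv_into_into)
  have path: "(?g x, ?g y) \<in> ?S\<^sup>*" if "(x, y) \<in> ?R\<^sup>*" for x y
    using that
  proof induction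
    case (step y z)
    then have "(?g y, ?g z) \<in> ?S" using fg by auto
    with step show ?case by (meson rtrancl.rtrancl_into_rtrancl)
  qed simp
  show ?thesis
  proof
    show "finite W" using bij_betw_finite[OF assms(2)] finite by simp
    show "W \<noteq> {}" using assms(2) nonempty by (auto simp: bij_betw_def)
    fix u v assume uv: "u \<in> W" "v \<in> W"
    show "a (f u) (f v) \<in> {-1, 0, 1}" using entries f uv by blast
    show "a (f u) (f v) = a (f v) (f u)" using sym f uv by blast
    show "(\<Sum>w \<in> W. a (f u) (f w) * a (f w) (f v)) = (if u = v then int k else 0)"
      using sum.reindex_bij_betw[OF assms(2), of "\<lambda>w. a (f u) w * a w (f v)"] square f inj uv
      by simp
    show "(u, v) \<in> ?S\<^sup>*" using path[OF connected[OF f[OF uv(1)] f[OF uv(2)]]] gf uv by simp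
  qed (use f diag in blast)
qed

text \<open>Doubling changes the index type from \<open>'a\<close> to
  \<open>'a \<times> bool\<close>. Moving back to \<open>nat\<close> lets it be iterated and puts
  all the graphs into one type. The cardinality is recorded because it will tell the graphs
  apart.\<close>

lemma signed_weighing_on_nat:
  assumes "signed_weighing V a k"
  shows "\<exists>(W :: nat set) b. signed_weighing W b k \<and> card W = card V"
proof -
  have "finite V" using assms by (rule signed_weighing.finite)
  then obtain f where "bij_betw f {0..<card V} V" using ex_bij_betw_nat_finite by blast
  from signed_weighing_reindex[OF assms this] show ?thesis by (metis card_atLeastLessThan diff_zero)
qed

section \<open>Doubling: from weight k to weight k + 1\<close>

definition double_entry :: "('a \<Rightarrow> 'a \<Rightarrow> int) \<Rightarrow> 'a \<times> bool \<Rightarrow> 'a \<times> bool \<Rightarrow> int" where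
  "double_entry a = (\<lambda>(u, s) (v, t).
     if s = t then (if s then - a u v else a u v) else if u = v then 1 else 0)"

text \<open>The diagonal blocks of the square are A^2 + I. The off-diagonal blocks are A - A = 0, by
  the opposite signs of the two copies of A. Paths lift to each copy, and the identity blocks join
  the copies.\<close>

lemma signed_weighing_double:
  assumes "signed_weighing V a k"
  shows "signed_weighing (V \<times> UNIV) (double_entry a) (Suc k)"
proof -
  interpret signed_weighing V a k by fact
  let ?R = "{(x, y). x \<in> V \<and> y \<in> V \<and> a x y \<noteq> 0}"
  let ?S = "{(x, y). x \<in> V \<times> UNIV \<and> y \<in> V \<times> UNIV \<and> double_entry a x y \<noteq> 0}"
  have path: "((u, s), (v, s)) \<in> ?S\<^sup>*" if "(u, v) \<in> ?R\<^sup>*" for u v s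
    using that
  proof induction
    case (step y z)
    then have "((y, s), (z, s)) \<in> ?S" by (auto simp: double_entry_def)
    with step show ?case by (meson rtrancl.rtrancl_into_rtrancl)
  qed simp
  have flip: "((u, s), (u, t)) \<in> ?S\<^sup>*" if "u \<in> V" for u s t
  proof (cases "s = t")
    case False
    then have "((u, s), (u, t)) \<in> ?S" using that by (simp add: double_entry_def)
    then show ?thesis by (rule r_into_rtrancl)
  qed simp
  show ?thesis
  proof
    show "finite (V \<times> (UNIV :: bool set))" using finite by simp
    show "V \<times> (UNIV :: bool set) \<noteq> {}" using nonempty by simp
    fix x y assume xy: "x \<in> V \<times> (UNIV :: bool set)" "y \<in> V \<times> (UNIV :: bool set)"
    obtain u s v t where [simp]: "x = (u, s)" "y = (v, t)" by fastforce
    have uv: "u \<in> V" "v \<in> V" using xy by auto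
    show "double_entry a x y \<in> {-1, 0, 1}"
      using entries[OF uv] by (auto simp: double_entry_def)
    show "double_entry a x y = double_entry a y x"
      using sym[OF uv] by (auto simp: double_entry_def)
    have "(\<Sum>w \<in> V \<times> UNIV. double_entry a x w * double_entry a w y) =
        (\<Sum>w \<in> V. \<Sum>r \<in> UNIV. double_entry a x (w, r) * double_entry a (w, r) y)"
      by (simp add: sum.cartesian_product case_prod_unfold)
    also have "\<dots> = (\<Sum>w \<in> V. double_entry a x (w, False) * double_entry a (w, False) y) +
        (\<Sum>w \<in> V. double_entry a x (w, True) * double_entry a (w, True) y)"
      by (simp add: UNIV_bool sum.distrib)
    also have "\<dots> = (if x = y then int (Suc k) else 0)"
      using square[OF uv] uv finite
      by (cases s; cases t)
        (auto simp: double_entry_def if_distrib[of "\<lambda>z. z * _"] if_distrib[of "\<lambda>z. _ * z"]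
          sum_negf sum.If_cases cong: if_cong)
    finally show "(\<Sum>w \<in> V \<times> UNIV. double_entry a x w * double_entry a w y) =
        (if x = y then int (Suc k) else 0)" .
    show "(x, y) \<in> ?S\<^sup>*"
      using path[OF connected[OF uv], of s] flip[OF uv(2), of s t] by simp
  next
    show "double_entry a x x = 0" if "x \<in> V \<times> UNIV" for x
      using that diag by (auto simp: double_entry_def)
  qed
qed

section \<open>The cyclic base case of weight 4\<close>

definition cyclic_entry :: "nat \<Rightarrow> nat \<times> bool \<Rightarrow> nat \<times> bool \<Rightarrow> int" where
  "cyclic_entry n = (\<lambda>(i, s) (j, t).
     (if j = Suc i mod n then (if s then -1 else 1) else 0) +
     (if i = Suc j mod n then (if t then -1 else 1) else 0))"

text \<open>As P P^T = P^T P = I, the mixed terms of the square add up to I tensor (B B^T + B^T B);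
  the other two contain B^2 or its transpose and vanish. With at least three points, the successor
  and the predecessor of a point differ, so the two summands never overlap and the entries stay in
  {-1, 0, 1}.\<close>

lemma signed_weighing_cyclic:
  assumes "n \<ge> 3"
  shows "signed_weighing ({..<n} \<times> UNIV) (cyclic_entry n) 4"
proof -
  let ?V = "{..<n} \<times> (UNIV :: bool set)"
  let ?S = "{(x, y). x \<in> ?V \<and> y \<in> ?V \<and> cyclic_entry n x y \<noteq> 0}"
  \<comment> \<open>Both columns of B are (1, -1), so an entry depends on its row alone.
    \<open>B t s\<close> then reads as an entry of the transpose.\<close>
  define B where "B s t = (if s then -1 else 1 :: int)" for s t :: bool
  define \<sigma> where "\<sigma> i = Suc i mod n" for i
  define \<pi> where "\<pi> i = (if i = 0 then n - 1 else i - 1)" for i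
  have \<sigma>: "\<sigma> i < n" "\<pi> i < n" "\<sigma> (\<pi> i) = i" "\<pi> (\<sigma> i) = i" "\<sigma> i \<noteq> i" "\<sigma> (\<sigma> i) \<noteq> i"
    if "i < n" for i
    using that assms by (auto simp: \<sigma>_def \<pi>_def mod_Suc)
  \<comment> \<open>Solving for \<open>j\<close> lets a sum over \<open>j\<close> collapse to a
    single term.\<close>
  have eq_\<sigma>: "i = \<sigma> j \<longleftrightarrow> j = \<pi> i" if "i < n" "j < n" for i j
    using \<sigma> that by metis
  have entry: "cyclic_entry n (i, s) (j, t) =
      (if j = \<sigma> i then B s t else 0) + (if i = \<sigma> j then B t s else 0)" for i s j t
    by (simp add: cyclic_entry_def \<sigma>_def B_def)
  \<comment> \<open>B has no zero entry, and the second summand vanishes because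
    \<open>\<sigma> (\<sigma> i) \<noteq> i\<close>. A path can therefore choose the Boolean freely
    whenever it moves on to the next point.\<close>
  have nonzero: "cyclic_entry n (i, s) (\<sigma> i, t) \<noteq> 0" if "i < n" for i s t
    using \<sigma>[OF that] by (auto simp: entry B_def)
  have sym: "cyclic_entry n x y = cyclic_entry n y x" for x y
    by (auto simp: cyclic_entry_def split: prod.splits)
  \<comment> \<open>By symmetry of the support it is enough to reach every vertex from
    \<open>(0, False)\<close>.\<close>
  have "Relation.sym ?S" by (rule symI) (auto simp: sym)
  then have sym_path: "(y, x) \<in> ?S\<^sup>*" if "(x, y) \<in> ?S\<^sup>*" for x y
    using that by (rule symD[OF sym_rtrancl])
  have from_0_Suc: "((0, False), (Suc i, s)) \<in> ?S\<^sup>*" if "Suc i < n" for i s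
    using that
  proof (induction i arbitrary: s)
    case 0
    then have "((0, False), (1, s)) \<in> ?S"
      using nonzero[of 0 False s] by (simp add: \<sigma>_def)
    then show ?case by auto
  next
    case (Suc i)
    then have "((Suc i, False), (Suc (Suc i), s)) \<in> ?S"
      using nonzero[of "Suc i" False s] by (simp add: \<sigma>_def)
    with Suc show ?case by (meson Suc_lessD rtrancl.rtrancl_into_rtrancl)
  qed
  \<comment> \<open>No arc joins two vertices over the same point, so \<open>(0, True)\<close> is
    reached by walking once around the cycle.\<close>
  have last_0: "((n - 1, False), (0, s)) \<in> ?S" for s
    using nonzero[of "n - 1" False s] assms by (simp add: \<sigma>_def)
  have "((0, False), (n - 1, False)) \<in> ?S\<^sup>*"
    using from_0_Suc[of "n - 2" False] assms by (simp add: numeral_2_eq_2 Suc_diff_Suc)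
  then have "((0, False), (0, s)) \<in> ?S\<^sup>*" for s
    using last_0 by (meson rtrancl.rtrancl_into_rtrancl)
  then have from_0: "((0, False), x) \<in> ?S\<^sup>*" if "x \<in> ?V" for x
    using that from_0_Suc by (cases x, cases "fst x") auto
  show ?thesis
  proof
    show "finite ?V" by simp
    show "?V \<noteq> {}" using assms by (auto simp: lessThan_empty_iff)
    fix x y assume xy: "x \<in> ?V" "y \<in> ?V"
    obtain i s j t where [simp]: "x = (i, s)" "y = (j, t)" by fastforce
    have ij: "i < n" "j < n" using xy by auto
    show "cyclic_entry n x y \<in> {-1, 0, 1}"
      using \<sigma>[OF ij(1)] by (auto simp: entry B_def)
    show "cyclic_entry n x y = cyclic_entry n y x" by (rule sym)
    have "(\<Sum>w \<in> ?V. cyclic_entry n x w * cyclic_entry n w y) =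
        (\<Sum>l < n. \<Sum>r \<in> UNIV. cyclic_entry n x (l, r) * cyclic_entry n (l, r) y)"
      by (simp add: sum.cartesian_product case_prod_unfold)
    \<comment> \<open>Only the two neighbours of \<open>i\<close> on the cycle contribute: the
      successor with row \<open>s\<close> of B, the predecessor with column
      \<open>s\<close>.\<close>
    also have "\<dots> = (\<Sum>l < n.
        (if l = \<sigma> i then \<Sum>r \<in> UNIV. B s r * cyclic_entry n (l, r) y else 0) +
        (if l = \<pi> i then \<Sum>r \<in> UNIV. B r s * cyclic_entry n (l, r) y else 0))"
    proof (intro sum.cong refl)
      fix l assume "l \<in> {..<n}"
      then have "i = \<sigma> l \<longleftrightarrow> l = \<pi> i" using eq_\<sigma> ij by simp
      then have "cyclic_entry n x (l, r) =
          (if l = \<sigma> i then B s r else 0) + (if l = \<pi> i then B r s else 0)" for r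
        by (simp only: entry \<open>x = (i, s)\<close>)
      then show "(\<Sum>r \<in> UNIV. cyclic_entry n x (l, r) * cyclic_entry n (l, r) y) =
          (if l = \<sigma> i then \<Sum>r \<in> UNIV. B s r * cyclic_entry n (l, r) y else 0) +
          (if l = \<pi> i then \<Sum>r \<in> UNIV. B r s * cyclic_entry n (l, r) y else 0)"
        by (simp only: distrib_right sum.distrib) simp
    qed
    also have "\<dots> = (\<Sum>r \<in> UNIV. B s r * cyclic_entry n (\<sigma> i, r) y) +
        (\<Sum>r \<in> UNIV. B r s * cyclic_entry n (\<pi> i, r) y)"
      using \<sigma>[OF ij(1)] by (simp add: sum.distrib)
    \<comment> \<open>The terms with \<open>j = \<sigma> (\<sigma> i)\<close> or
      \<open>i = \<sigma> (\<sigma> j)\<close> carry entries of B^2 = 0. Those with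
      \<open>i = j\<close> carry entries of B B^T and B^T B.\<close>
    also have "\<dots> = (if x = y then int 4 else 0)"
    proof -
      have "cyclic_entry n (\<sigma> i, r) y = (if j = \<sigma> (\<sigma> i) then B r t else 0) + (if i = j then B t r else 0)"
        for r
      proof -
        have "\<sigma> i = \<sigma> j \<longleftrightarrow> i = j" using \<sigma> ij by metis
        then show ?thesis by (simp only: entry \<open>y = (j, t)\<close>)
      qed
      moreover have "cyclic_entry n (\<pi> i, r) y =
          (if i = j then B r t else 0) + (if i = \<sigma> (\<sigma> j) then B t r else 0)" for r
      proof -
        have "j = \<sigma> (\<pi> i) \<longleftrightarrow> i = j" "\<pi> i = \<sigma> j \<longleftrightarrow> i = \<sigma> (\<sigma> j)"
          using eq_\<sigma>[of i "\<sigma> j"] \<sigma> ij by auto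
        then show ?thesis by (simp only: entry \<open>y = (j, t)\<close>)
      qed
      ultimately show ?thesis
        by (cases s; cases t; simp add: B_def UNIV_bool)
    qed
    finally show "(\<Sum>w \<in> ?V. cyclic_entry n x w * cyclic_entry n w y) = (if x = y then int 4 else 0)" .
    show "(x, y) \<in> ?S\<^sup>*" using from_0 sym_path xy by (meson rtrancl_trans)
  next
    show "cyclic_entry n x x = 0" if "x \<in> ?V" for x
    proof -
      obtain i s where x: "x = (i, s)" by fastforce
      with that have "i < n" by simp
      from \<sigma>(5)[OF this] have "i \<noteq> \<sigma> i" by simp
      then show ?thesis by (simp add: x entry)
    qed
  qed
qed

text \<open>The order is 2n in the cyclic case and doubles \<open>m\<close> times, so for fixed
  weight it still determines \<open>n\<close>. This gives infinitely many examples.\<close>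

lemma exists_signed_weighing:
  assumes "n \<ge> 3"
  shows "\<exists>(V :: nat set) a. signed_weighing V a (4 + m) \<and> card V = 2 ^ Suc m * n"
proof (induction m)
  case 0
  show ?case
    using signed_weighing_on_nat[OF signed_weighing_cyclic[OF assms]]
    by (simp add: card_cartesian_product mult.commute)
next
  case (Suc m)
  then obtain V :: "nat set" and a where V: "signed_weighing V a (4 + m)" "card V = 2 ^ Suc m * n"
    by blast
  have "card (V \<times> (UNIV :: bool set)) = 2 ^ Suc (Suc m) * n"
    using V(2) by (simp add: card_cartesian_product)
  then show ?case
    using signed_weighing_on_nat[OF signed_weighing_double[OF V(1)]] by (simp only: add_Suc_right)
qed

section \<open>From weighing matrices to signed graphs\<close>

definition weighing_graph :: "'a::linorder set \<Rightarrow> ('a \<Rightarrow> 'a \<Rightarrow> int) \<Rightarrow> 'a signed_graph" where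
  "weighing_graph V a =
     \<lparr>ground = \<lparr>pverts = V, parcs = {(u, v). u \<in> V \<and> v \<in> V \<and> a u v \<noteq> 0}\<rparr>,
      sign = (\<lambda>e. a (Min e) (Max e))\<rparr>"

locale linorder_signed_weighing = signed_weighing V a k
  for V :: "'a::linorder set" and a k
begin

abbreviation G :: "'a signed_graph" where "G \<equiv> weighing_graph V a"

lemma pverts_G [simp]: "pverts (ground G) = V"
  by (simp add: weighing_graph_def)

lemma parcs_G: "(u, v) \<in> parcs (ground G) \<longleftrightarrow> u \<in> V \<and> v \<in> V \<and> a u v \<noteq> 0"
  by (simp add: weighing_graph_def)

text \<open>A sign is a function of an unordered edge, and the linear order serves to pick one of
  the two matrix entries. By symmetry of \<open>a\<close> the choice does not matter.\<close>

lemma sign_G: "u \<in> V \<Longrightarrow> v \<in> V \<Longrightarrow> sign G {u, v} = a u v"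
  using sym[of u v] by (simp add: weighing_graph_def min_def max_def)

lemma adj_entry_G: "u \<in> V \<Longrightarrow> v \<in> V \<Longrightarrow> adj_entry G u v = of_int (a u v)"
  by (simp add: adj_entry_def parcs_G sign_G)

lemma pair_graph_G: "pair_graph (ground G)"
proof
  have "parcs (ground G) \<subseteq> V \<times> V" by (auto simp: parcs_G)
  then show "finite (parcs (ground G))" using finite finite_subset by blast
  show "symmetric (with_proj (ground G))"
    unfolding symmetric_def by (rule symI) (auto simp: parcs_G sym)
  show "fst e \<noteq> snd e" if "e \<in> parcs (ground G)" for e
    using that diag by (cases e) (auto simp: parcs_G)
qed (auto simp: finite parcs_G)

lemma signed_graph_G: "signed_graph G"
proof -
  have "sign G {u, v} \<in> {1, -1}" if "(u, v) \<in> parcs (ground G)" for u v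
    using entries[of u v] that by (auto simp: parcs_G sign_G)
  then show ?thesis unfolding signed_graph_def using pair_graph_G by blast
qed

lemma signed_connected_G: "signed_connected G"
proof -
  interpret pair_graph "ground G" by (rule pair_graph_G)
  have "u \<rightarrow>\<^sup>*\<^bsub>with_proj (ground G)\<^esub> v" if "u \<in> V" "v \<in> V" for u v
    using connected[OF that] that(2)
  proof (induction rule: converse_rtrancl_induct)
    case (step x y)
    then have "(x, y) \<in> parcs (ground G)" by (auto simp: parcs_G)
    with step show ?case by (meson adj_reachable_trans)
  qed simp
  \<comment> \<open>Connectedness here means strong connectedness of the symmetric closure, with a
    nonempty vertex set; reachability in the digraph itself carries over to the closure.\<close>
  then show ?thesis
    unfolding signed_connected_def Digraph_Component.connected_def
    using nonempty by (auto intro!: strongly_connectedI reachable_mk_symmetricI)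
qed

lemma signed_regular_G: "signed_regular k G"
  unfolding signed_regular_def
proof
  fix u assume "u \<in> pverts (ground G)"
  then have u: "u \<in> V" by simp
  have "out_arcs (with_proj (ground G)) u = (\<lambda>v. (u, v)) ` {v \<in> V. a u v \<noteq> 0}"
    using u by (auto simp: out_arcs_def parcs_G)
  then have "out_degree (with_proj (ground G)) u = card {v \<in> V. a u v \<noteq> 0}"
    by (simp add: out_degree_def card_image inj_on_def)
  also have "int \<dots> = (\<Sum>v \<in> V. if a u v \<noteq> 0 then 1 else 0)"
    using finite by (simp add: sum.If_cases Int_def)
  \<comment> \<open>By symmetry each product is the square of an entry 0, 1 or -1, hence the
    indicator of adjacency.\<close>
  also have "\<dots> = (\<Sum>v \<in> V. a u v * a v u)"
  proof (intro sum.cong refl)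
    fix v assume "v \<in> V"
    then show "(if a u v \<noteq> 0 then 1 else 0) = a u v * a v u"
      using entries[OF u, of v] sym[OF u, of v] by auto
  qed
  also have "\<dots> = int k" using square[OF u u] by simp
  finally show "out_degree (with_proj (ground G)) u = k" by simp
qed

text \<open>This is A (A f) = k f for complex f: after exchanging the sums, the inner one is an
  entry of the integer matrix A^2.\<close>

lemma square_complex:
  assumes "u \<in> V"
  shows "(\<Sum>w \<in> V. of_int (a u w) * (\<Sum>z \<in> V. of_int (a w z) * f z)) = of_nat k * (f u :: complex)"
proof -
  have "(\<Sum>w \<in> V. of_int (a u w) * (\<Sum>z \<in> V. of_int (a w z) * f z)) =
      (\<Sum>w \<in> V. \<Sum>z \<in> V. of_int (a u w * a w z) * f z)"
    by (simp add: sum_distrib_left mult.assoc)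
  also have "\<dots> = (\<Sum>z \<in> V. \<Sum>w \<in> V. of_int (a u w * a w z) * f z)"
    by (rule sum.swap)
  also have "\<dots> = (\<Sum>z \<in> V. of_int (\<Sum>w \<in> V. a u w * a w z) * f z)"
    by (simp add: sum_distrib_right)
  also have "\<dots> = (\<Sum>z \<in> V. if u = z then of_nat k * f z else 0)"
    using assms by (intro sum.cong refl) (simp add: square)
  finally show ?thesis using assms finite by simp
qed

lemma signed_eigenvalues_G:
  assumes "k > 0"
  shows "signed_eigenvalues G = {complex_of_real (sqrt (real k)), - complex_of_real (sqrt (real k))}"
proof -
  let ?r = "complex_of_real (sqrt (real k))"
  have r: "?r * ?r = of_nat k"
    by (simp only: of_real_mult[symmetric]) simp
  obtain vs where vs: "vs \<in> vertex_orderings G"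
    using finite_distinct_list[OF finite] by (auto simp: vertex_orderings_def)
  have "x \<in> signed_eigenvalues G \<longleftrightarrow> (\<exists>f. (\<exists>u \<in> V. f u \<noteq> 0) \<and>
      (\<forall>u \<in> V. (\<Sum>w \<in> V. of_int (a u w) * f w) = x * f u))" for x
    using eigenvalue_adj_matrix_iff[OF vs, of x]
    by (simp add: signed_eigenvalues_eq_spectrum[OF vs] spectrum_def adj_entry_G cong: sum.cong)
  note ev = this
  have "x = ?r \<or> x = - ?r" if x: "x \<in> signed_eigenvalues G" for x
  proof -
    obtain f u where u: "u \<in> V" "f u \<noteq> 0"
      and f: "\<And>u. u \<in> V \<Longrightarrow> (\<Sum>w \<in> V. of_int (a u w) * f w) = x * f u"
      using x unfolding ev by blast
    \<comment> \<open>Applying A twice to an eigenfunction multiplies it by both k and x^2.\<close>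
    have "of_nat k * f u = (\<Sum>w \<in> V. of_int (a u w) * (x * f w))"
      using square_complex[OF u(1), of f] f by simp
    also have "\<dots> = x * (\<Sum>w \<in> V. of_int (a u w) * f w)"
      by (simp add: sum_distrib_left mult.left_commute)
    also have "\<dots> = x * x * f u" using f[OF u(1)] by simp
    finally have "x * x = ?r * ?r" using u(2) r by simp
    then show ?thesis by (simp only: square_eq_iff)
  qed
  moreover have "x \<in> signed_eigenvalues G" if x: "x * x = of_nat k" for x
  proof -
    obtain v where v: "v \<in> V" using nonempty by blast
    define e where "e u = (if u = v then 1 else 0 :: complex)" for u
    \<comment> \<open>With x^2 = k, (A - x I)(A + x I) = A^2 - k I = 0, so every nonzero image of A
      + x I is an eigenfunction for x. For the unit vector \<open>e\<close> at \<open>v\<close>, the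
      zero diagonal makes the value at \<open>v\<close> equal to \<open>x\<close>, which is nonzero
      as k is positive.\<close>
    define f where "f u = (\<Sum>w \<in> V. of_int (a u w) * e w) + x * e u" for u
    have "f v = x"
      using v finite diag[OF v] by (simp add: f_def e_def if_distrib cong: if_cong)
    moreover have "x \<noteq> 0" using x assms by auto
    moreover have "(\<Sum>w \<in> V. of_int (a u w) * f w) = x * f u" if u: "u \<in> V" for u
    proof -
      have "(\<Sum>w \<in> V. of_int (a u w) * f w) =
          (\<Sum>w \<in> V. of_int (a u w) * (\<Sum>z \<in> V. of_int (a w z) * e z)) +
          x * (\<Sum>w \<in> V. of_int (a u w) * e w)"
        by (simp add: f_def distrib_left sum.distrib sum_distrib_left mult.left_commute)
      then show ?thesis by (simp add: square_complex[OF u] f_def distrib_left flip: x mult.assoc)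
    qed
    ultimately show ?thesis unfolding ev using v by metis
  qed
  ultimately show ?thesis using r by auto
qed

end

section \<open>Infinitely many pairwise non-isomorphic graphs\<close>

theorem theorem3p10:
  fixes k :: nat
  assumes "k \<ge> 4"
  shows "\<exists>S :: nat signed_graph set. infinite S \<and>
    (\<forall>G \<in> S. signed_graph G \<and> signed_connected G \<and> signed_regular k G \<and>
       signed_eigenvalues G = {complex_of_real (sqrt (real k)), - complex_of_real (sqrt (real k))}) \<and>
    pairwise (\<lambda>G H. \<not> signed_iso G H) S"
proof -
  have k: "4 + (k - 4) = k" using assms by simp
  have "\<forall>n \<in> {3..}. \<exists>p. signed_weighing (fst p) (snd p) k \<and>
      card (fst p :: nat set) = 2 ^ Suc (k - 4) * n"
    using exists_signed_weighing[of _ "k - 4", unfolded k] by fastforce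
  then obtain p :: "nat \<Rightarrow> nat set \<times> (nat \<Rightarrow> nat \<Rightarrow> int)"
    where p: "\<And>n. n \<ge> 3 \<Longrightarrow> signed_weighing (fst (p n)) (snd (p n)) k"
      and card_p: "\<And>n. n \<ge> 3 \<Longrightarrow> card (fst (p n)) = 2 ^ Suc (k - 4) * n"
    unfolding bchoice_iff by auto
  define F where "F n = weighing_graph (fst (p n)) (snd (p n))" for n
  have card_F: "card (pverts (ground (F n))) = 2 ^ Suc (k - 4) * n" if "n \<ge> 3" for n
    using card_p[OF that] by (simp add: F_def weighing_graph_def)
  \<comment> \<open>The order of a graph is an isomorphism invariant, and here it is a fixed
    positive multiple of the parameter.\<close>
  have iso: "m = n" if "m \<ge> 3" "n \<ge> 3" "signed_iso (F m) (F n)" for m n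
  proof -
    have "card (pverts (ground (F m))) = card (pverts (ground (F n)))"
      using that(3) unfolding signed_iso_def by (blast dest: bij_betw_same_card)
    then show ?thesis using card_F that by simp
  qed
  have "inj_on F {3..}"
  proof (rule inj_onI)
    fix m n assume "m \<in> {3..}" "n \<in> {3..}" "F m = F n"
    then have "2 ^ Suc (k - 4) * m = 2 ^ Suc (k - 4) * n" using card_F by (metis atLeast_iff)
    then show "m = n" by simp
  qed
  then have "infinite (F ` {3..})" using infinite_Ici finite_imageD by blast
  moreover have "signed_graph G \<and> signed_connected G \<and> signed_regular k G \<and>
      signed_eigenvalues G = {complex_of_real (sqrt (real k)), - complex_of_real (sqrt (real k))}"
    if "G \<in> F ` {3..}" for G
  proof -
    obtain n where n: "n \<ge> 3" "G = F n" using \<open>G \<in> F ` {3..}\<close> by auto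
    interpret linorder_signed_weighing "fst (p n)" "snd (p n)" k
      using p[OF n(1)] by (simp add: linorder_signed_weighing_def)
    show ?thesis
      using signed_graph_G signed_connected_G signed_regular_G signed_eigenvalues_G assms
      by (simp add: n(2) F_def)
  qed
  moreover have "pairwise (\<lambda>G H. \<not> signed_iso G H) (F ` {3..})"
    using iso by (auto simp: pairwise_def)
  ultimately show ?thesis by blast
qed

end
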